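(* Let $\mathbf{I}_1$ and $\mathbf{I}_2$ be two distinct $\mathcal{SP}$-maximal ideals. Then there is $A\in\mathbf{I}_1$ such that $(\mathbb{R}^+\setminus A)\in\mathbf{I}_2$.
   Context: $\mathbb{R}^+=[0,\infty)$. For $E\subseteq\mathbb{R}^+$ and $h>0$, $\lambda(E,h)$ denotes the length of the largest open subinterval of $(0,h)$ that contains no point of $E$ (and $\lambda(E,h)=0$ if there is no such nonempty interval). The right upper porosity of $E$ at $0$ is $\overline{p}(E)=\limsup_{h\to 0^+}\frac{\lambda(E,h)}{h}$. The set $E$ is strongly porous at $0$ if $\overline{p}(E)=1$. $\mathcal{SP}$ denotes the set of all subsets of $\mathbb{R}^+$ that are strongly porous at $0$. A nonempty collection $\mathbf{I}$ of subsets of a set $X$ is an ideal on $X$ if: (1) $B\in\mathbf{I}$ and $C\subseteq B$ imply $C\in\mathbf{I}$; (2) $B\cup C\in\mathbf{I}$ for all $B,C\in\mathbf{I}$; (3) $X\notin\mathbf{I}$. An ideal $\mathbf{I}$ on $\mathbb{R}^+$ is $\mathcal{SP}$-maximal if $\mathbf{I}\subseteq\mathcal{SP}$ and, for every ideal $\mathbf{J}$ on $\mathbb{R}^+$, $\mathbf{I}\subseteq\mathbf{J}\subseteq\mathcal{SP}$ implies $\mathbf{I}=\mathbf{J}$. *)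

theory Defs
  imports "HOL-Analysis.Analysis"
begin

abbreviation nonneg_reals :: "real set" where
  "nonneg_reals \<equiv> {0..}"

(* The degenerate case a = b contributes the length 0, so the supremum is over a nonempty set
   and equals 0 if there is no nonempty gap. It is attained (gap_length_attained), so it is the
   length of a largest gap. *)
definition gap_length :: "real set \<Rightarrow> real \<Rightarrow> real" where
  "gap_length E h =
     Sup {b - a | a b. a \<le> b \<and> {a<..<b} \<subseteq> {0<..<h} \<and> {a<..<b} \<inter> E = {}}"

(* Limsup is taken in the complete lattice ereal. *)
definition right_upper_porosity :: "real set \<Rightarrow> ereal" where
  "right_upper_porosity E = Limsup (at_right 0) (\<lambda>h. ereal (gap_length E h / h))"

definition strongly_porous :: "real set \<Rightarrow> bool" where
  "strongly_porous E \<longleftrightarrow> right_upper_porosity E = 1"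

definition SP :: "real set set" where
  "SP = {E. E \<subseteq> nonneg_reals \<and> strongly_porous E}"

definition ideal_on :: "'a set \<Rightarrow> 'a set set \<Rightarrow> bool" where
  "ideal_on X I \<longleftrightarrow>
     I \<subseteq> Pow X \<and> I \<noteq> {} \<and>
     (\<forall>B C. B \<in> I \<and> C \<subseteq> B \<longrightarrow> C \<in> I) \<and>
     (\<forall>B C. B \<in> I \<and> C \<in> I \<longrightarrow> B \<union> C \<in> I) \<and>
     X \<notin> I"

definition SP_maximal :: "real set set \<Rightarrow> bool" where
  "SP_maximal I \<longleftrightarrow>
     ideal_on nonneg_reals I \<and> I \<subseteq> SP \<and>
     (\<forall>J. ideal_on nonneg_reals J \<and> I \<subseteq> J \<and> J \<subseteq> SP \<longrightarrow> I = J)"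

lemma gap_length_attained:
  assumes "h > 0"
  obtains a b where "a \<le> b" "{a<..<b} \<subseteq> {0<..<h}" "{a<..<b} \<inter> E = {}" "gap_length E h = b - a"
proof -
  define K where "K = ({0..h} \<times> {0..h}) \<inter> {p. fst p \<le> snd p} \<inter> (\<Inter>e\<in>E. {p. e \<le> fst p} \<union> {p. snd p \<le> e})"
  have "closed ({p. fst p \<le> snd p} \<inter> (\<Inter>e\<in>E. {p::real\<times>real. e \<le> fst p} \<union> {p. snd p \<le> e}))"
    by (intro closed_Int closed_INT ballI closed_Un closed_Collect_le continuous_intros)
  hence "compact K"
    unfolding K_def Int_assoc by (intro compact_Int_closed compact_Times compact_Icc)
  have "(0, 0) \<in> K" using assms by (force simp: K_def)
  obtain p where p: "p \<in> K" "\<And>q. q \<in> K \<Longrightarrow> snd q - fst q \<le> snd p - fst p"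
  proof -
    have "continuous_on K (\<lambda>p. snd p - fst p)" by (intro continuous_intros)
    with \<open>compact K\<close> \<open>(0, 0) \<in> K\<close> have "\<exists>p\<in>K. \<forall>q\<in>K. snd q - fst q \<le> snd p - fst p"
      by (intro continuous_attains_sup) auto
    thus thesis using that by blast
  qed
  obtain a b where ab: "p = (a, b)" by (cases p)
  have K: "0 \<le> a" "a \<le> b" "b \<le> h" "{a<..<b} \<inter> E = {}"
  proof -
    have "0 \<le> a \<and> a \<le> b \<and> b \<le> h" and "\<forall>e\<in>E. e \<le> a \<or> b \<le> e"
      using p(1) unfolding K_def ab by simp_all
    thus "0 \<le> a" "a \<le> b" "b \<le> h" "{a<..<b} \<inter> E = {}"
      by (simp_all add: disjoint_iff not_less) (meson not_le)
  qed
  have sub: "{a<..<b} \<subseteq> {0<..<h}" using K by auto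
  have "gap_length E h = b - a" unfolding gap_length_def
  proof (rule cSup_eq_maximum)
    show "b - a \<in> {b - a |a b. a \<le> b \<and> {a<..<b} \<subseteq> {0<..<h} \<and> {a<..<b} \<inter> E = {}}"
      using K sub by blast
    fix x assume "x \<in> {b - a |a b. a \<le> b \<and> {a<..<b} \<subseteq> {0<..<h} \<and> {a<..<b} \<inter> E = {}}"
    then obtain c d where cd: "x = d - c" "c \<le> d" "{c<..<d} \<subseteq> {0<..<h}" "{c<..<d} \<inter> E = {}"
      by blast
    show "x \<le> b - a"
    proof (cases "c = d")
      case False
      hence "0 \<le> c" "d \<le> h" using cd(2,3) by (simp_all add: greaterThanLessThan_subseteq_greaterThanLessThan)
      moreover have "\<And>e. e \<in> E \<Longrightarrow> e \<le> c \<or> d \<le> e" using cd(4) by (force simp: disjoint_iff not_le)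
      ultimately have "(c, d) \<in> K" using cd(2) unfolding K_def by auto
      thus ?thesis using p(2)[of "(c, d)"] cd(1) ab by simp
    qed (use cd K in auto)
  qed
  thus thesis using that K sub by blast
qed

end

theory Submission
  imports Defs
begin

text \<open>
  Strong porosity at \<open>0\<close> is a multiplicative condition: \<open>E\<close> is strongly porous iff arbitrarily
  close to \<open>0\<close> it has gaps \<open>(x, Kx)\<close> with arbitrarily large ratio \<open>K\<close>
  (\<open>strongly_porous_iff_gaps\<close>). Hence fattening a part of \<open>E\<close> by a fixed factor \<open>K\<close> is harmless:
  a gap of ratio \<open>M * K^2\<close> shrinks to one of ratio \<open>M\<close>. Points away from \<open>0\<close> do not matter
  either. A maximal ideal absorbs every set whose unions with all its members are strongly porous
  (\<open>SP_maximal_absorbs\<close>), and so it is closed under fattening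
  (\<open>SP_maximal_fattening\<close>).

  If all unions \<open>A \<union> B\<close> with \<open>A \<in> I1\<close>, \<open>B \<in> I2\<close> were strongly porous, each ideal would absorb the
  other and they would coincide. So for some \<open>A\<close>, \<open>B\<close> the set \<open>A \<union> B\<close> meets every interval
  \<open>(x, Kx)\<close> with \<open>0 < x < \<delta>\<close>, for some \<open>K\<close> and \<open>\<delta>\<close>. Then the fattenings of \<open>A\<close> and \<open>B\<close> by the
  factor \<open>K\<close> cover \<open>(0, \<delta>)\<close>; adding \<open>0\<close> and \<open>[\<delta>, \<infinity>)\<close> to the fattening of \<open>A\<close> gives the
  required member of \<open>I1\<close>, whose complement lies in the fattening of \<open>B\<close>.
\<close>

lemma gap_length_bounds:
  assumes "h > 0"
  shows "0 \<le> gap_length E h" "gap_length E h \<le> h"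
proof -
  obtain a b where ab: "a \<le> b" "{a<..<b} \<subseteq> {0<..<h}" "gap_length E h = b - a"
    using gap_length_attained[OF assms] by metis
  show "0 \<le> gap_length E h" using ab by simp
  show "gap_length E h \<le> h"
    using ab assms by (cases "a = b") (auto simp: greaterThanLessThan_subseteq_greaterThanLessThan)
qed

lemma gap_length_ge:
  assumes "a \<le> b" "{a<..<b} \<subseteq> {0<..<h}" "{a<..<b} \<inter> E = {}" "h > 0"
  shows "b - a \<le> gap_length E h"
  unfolding gap_length_def
proof (rule cSup_upper)
  show "bdd_above {b - a |a b. a \<le> b \<and> {a<..<b} \<subseteq> {0<..<h} \<and> {a<..<b} \<inter> E = {}}"
  proof (rule bdd_aboveI[of _ h])
    fix x assume "x \<in> {b - a |a b. a \<le> b \<and> {a<..<b} \<subseteq> {0<..<h} \<and> {a<..<b} \<inter> E = {}}"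
    then obtain c d where "x = d - c" "c \<le> d" "{c<..<d} \<subseteq> {0<..<h}" by blast
    then show "x \<le> h" using \<open>h > 0\<close>
      by (cases "c = d") (auto simp: greaterThanLessThan_subseteq_greaterThanLessThan)
  qed
qed (use assms in blast)

text \<open>
  A gap of relative length \<open>1 - 1/K\<close> in \<open>(0, h)\<close> has right end at least \<open>K\<close> times its left end, and
  conversely a gap \<open>(x, Kx)\<close> has relative length \<open>1 - 1/K\<close> in \<open>(0, Kx)\<close>.
\<close>

lemma strongly_porous_iff_gaps:
  "strongly_porous E \<longleftrightarrow> (\<forall>K>1. \<forall>\<delta>>0. \<exists>x>0. x < \<delta> \<and> {x<..<K * x} \<inter> E = {})"
proof (intro iffI allI impI)
  fix K \<delta> :: real
  assume sp: "strongly_porous E" and K: "K > 1" and \<delta>: "\<delta> > 0"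
  define q where "q = 1 - 1 / K"
  have q: "0 < q" "q < 1" using K by (auto simp: q_def)
  have "\<not> (\<forall>\<^sub>F h in at_right 0. gap_length E h / h \<le> q)"
  proof
    assume "\<forall>\<^sub>F h in at_right 0. gap_length E h / h \<le> q"
    then have "right_upper_porosity E \<le> ereal q"
      unfolding right_upper_porosity_def by (intro Limsup_bounded) simp
    then show False using sp q by (simp add: strongly_porous_def one_ereal_def)
  qed
  then obtain h where h: "0 < h" "h < \<delta>" "gap_length E h / h > q"
    using \<delta> unfolding eventually_at_right_field by (auto simp: not_le)
  obtain a b where ab: "a \<le> b" "{a<..<b} \<subseteq> {0<..<h}" "{a<..<b} \<inter> E = {}"
      "gap_length E h = b - a"
    using gap_length_attained[OF h(1)] by metis
  have long: "b - a > q * h" using h ab(4) by (simp add: field_simps)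
  then have "a < b" using q h by (smt (verit) mult_pos_pos)
  then have in_h: "0 \<le> a" "b \<le> h"
    using ab(2) by (auto simp: greaterThanLessThan_subseteq_greaterThanLessThan)
  have "q * b \<le> q * h" using in_h q by simp
  then have "a \<le> b / K" using long by (simp add: q_def algebra_simps)
  moreover have "b / K < \<delta>"
    using in_h h \<open>a < b\<close> K by (smt (verit) divide_less_eq_1 mult_less_cancel_left2 pos_divide_less_eq)
  ultimately show "\<exists>x>0. x < \<delta> \<and> {x<..<K * x} \<inter> E = {}"
    using ab(3) K \<open>a < b\<close> in_h by (intro exI[of _ "b / K"]) (auto simp: disjoint_iff)
next
  assume gaps: "\<forall>K>1. \<forall>\<delta>>0. \<exists>x>0. x < \<delta> \<and> {x<..<K * x} \<inter> E = {}"
  have "right_upper_porosity E \<le> 1"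
    unfolding right_upper_porosity_def
    by (intro Limsup_bounded eventually_at_rightI[of 0 1]) (use gap_length_bounds in auto)
  moreover have "\<not> right_upper_porosity E < 1"
  proof
    assume "right_upper_porosity E < 1"
    then obtain r where r: "right_upper_porosity E < ereal r" "ereal r < 1"
      using ereal_dense2 by blast
    have "\<forall>\<^sub>F h in at_right 0. ereal (gap_length E h / h) < ereal r"
      using r(1) unfolding right_upper_porosity_def by (rule Limsup_lessD)
    then obtain \<delta> where \<delta>: "\<delta> > 0" "\<And>h. 0 < h \<Longrightarrow> h < \<delta> \<Longrightarrow> gap_length E h / h < r"
      unfolding eventually_at_right_field by auto
    \<comment> \<open>\<open>r\<close> may be negative, while \<open>K = 1 / (1 - q)\<close> exceeds \<open>1\<close> only for positive \<open>q\<close>.\<close>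
    define q where "q = max r (1 / 2)"
    have q: "0 < q" "q < 1" "r \<le> q" using r(2) by (auto simp: q_def)
    define K where "K = 1 / (1 - q)"
    have K: "K > 1" using q by (simp add: K_def)
    obtain x where x: "0 < x" "x < \<delta> / K" "{x<..<K * x} \<inter> E = {}"
      using gaps K \<delta>(1) by (metis divide_pos_pos less_trans zero_less_one)
    have Kx: "0 < K * x" "K * x < \<delta>" "x \<le> K * x" using x K by (auto simp: field_simps)
    have "K * x - x \<le> gap_length E (K * x)"
      using x Kx by (intro gap_length_ge) auto
    also have "\<dots> < q * (K * x)"
      using \<delta>(2)[OF Kx(1,2)] q(3) Kx(1) by (smt (verit) pos_divide_less_eq mult_right_mono)
    finally have "K * (1 - q) * x < x" by (simp add: algebra_simps)
    moreover have "K * (1 - q) = 1" using q by (simp add: K_def)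
    ultimately show False by simp
  qed
  ultimately show "strongly_porous E" by (simp add: strongly_porous_def)
qed

lemma strongly_porous_subset:
  assumes "strongly_porous E" "F \<subseteq> E"
  shows "strongly_porous F"
  using assms unfolding strongly_porous_iff_gaps by (meson disjoint_iff subsetD)

lemma not_strongly_porous_nonneg_reals: "\<not> strongly_porous nonneg_reals"
proof
  assume "strongly_porous nonneg_reals"
  then obtain x :: real where x: "x > 0" "{x<..<2 * x} \<inter> {0..} = {}"
    unfolding strongly_porous_iff_gaps by (metis one_less_numeral_iff semiring_norm(76) zero_less_one)
  have "3 / 2 * x \<in> {x<..<2 * x} \<inter> {0..}" using x(1) by simp
  with x(2) show False by (metis emptyE)
qed

text \<open>
  For \<open>K \<ge> 1\<close> the fattening consists of all products of a positive element of \<open>A\<close> with a factor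
  from \<open>[1/K, K]\<close>, together with \<open>0\<close> if \<open>0 \<in> A\<close>.
\<close>

definition fattening :: "real \<Rightarrow> real set \<Rightarrow> real set" where
  "fattening K A = {x \<in> nonneg_reals. \<exists>a\<in>A. x \<le> K * a \<and> a \<le> K * x}"

text \<open>
  A gap \<open>(x, M * K^2 * x)\<close> of \<open>C \<union> A\<close> leaves the gap \<open>(K * x, M * K * x)\<close> after fattening \<open>A\<close>;
  for small \<open>x\<close> this gap also avoids \<open>[c, \<infinity>)\<close>.
\<close>

lemma strongly_porous_fattening:
  assumes sp: "strongly_porous (C \<union> A)" and K: "K \<ge> 1" and c: "c > 0"
  shows "strongly_porous (C \<union> (fattening K A \<union> {0} \<union> {c..}))"
  unfolding strongly_porous_iff_gaps
proof (intro allI impI)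
  fix M \<delta> :: real
  assume M: "M > 1" and \<delta>: "\<delta> > 0"
  have MKK: "M * K * K > 1" using M K
    by (smt (verit) mult_le_cancel_left1)
  have MK: "0 < M * K" "K \<le> M * K" using M K by auto
  have "min \<delta> c / (M * K) > 0" using MK c \<delta> by simp
  then obtain x where x: "0 < x" "x < min \<delta> c / (M * K)" "{x<..<M * K * K * x} \<inter> (C \<union> A) = {}"
    using sp MKK unfolding strongly_porous_iff_gaps by blast
  have small: "M * K * x < min \<delta> c" using x(2) MK(1) by (simp add: pos_less_divide_eq mult.commute)
  have ord: "x \<le> K * x" "K * x \<le> M * K * x" "M * K * x \<le> M * K * K * x"
    using x(1) K MK by auto
  show "\<exists>y>0. y < \<delta> \<and> {y<..<M * y} \<inter> (C \<union> (fattening K A \<union> {0} \<union> {c..})) = {}"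
  proof (intro exI[of _ "K * x"] conjI)
    show "K * x > 0" "K * x < \<delta>" using x(1) K order.strict_trans1[OF ord(2) small] by simp_all
    have False if z: "K * x < z" "z < M * (K * x)"
      and mem: "z \<in> C \<union> (fattening K A \<union> {0} \<union> {c..})" for z
    proof -
      have "x < z" using ord(1) z(1) by (rule le_less_trans)
      have "z < M * K * x" using z(2) by (simp add: mult.assoc)
      then have "z < c" "z \<in> {x<..<M * K * K * x}"
        using \<open>x < z\<close> small ord(3) by auto
      then have "z \<noteq> 0" "z \<notin> C" using x(1,3) by auto
      with mem \<open>z < c\<close> obtain a where a: "a \<in> A" "z \<le> K * a" "a \<le> K * z"
        by (auto simp: fattening_def)
      have "K * x < K * a" using z(1) a(2) by simp
      then have "x < a" using K by simp
      moreover have "K * z < K * (M * (K * x))" using z(2) K by simp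
      then have "a < M * K * K * x" using a(3) by (simp add: algebra_simps)
      ultimately show False using x(3) a(1) by auto
    qed
    then show "{K * x<..<M * (K * x)} \<inter> (C \<union> (fattening K A \<union> {0} \<union> {c..})) = {}"
      unfolding disjoint_iff greaterThanLessThan_iff by blast
  qed
qed

lemma SP_maximal_ideal:
  assumes "SP_maximal I"
  shows "I \<subseteq> Pow nonneg_reals" "{} \<in> I"
    "\<And>B C. B \<in> I \<Longrightarrow> C \<subseteq> B \<Longrightarrow> C \<in> I" "\<And>B C. B \<in> I \<Longrightarrow> C \<in> I \<Longrightarrow> B \<union> C \<in> I"
proof -
  have "ideal_on nonneg_reals I" using assms by (simp add: SP_maximal_def)
  then show "I \<subseteq> Pow nonneg_reals"
    and sub: "\<And>B C. B \<in> I \<Longrightarrow> C \<subseteq> B \<Longrightarrow> C \<in> I"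
    and "\<And>B C. B \<in> I \<Longrightarrow> C \<in> I \<Longrightarrow> B \<union> C \<in> I"
    unfolding ideal_on_def by meson+
  have "I \<noteq> {}" using \<open>ideal_on nonneg_reals I\<close> by (simp add: ideal_on_def)
  then show "{} \<in> I" using sub by blast
qed

text \<open>
  The sets \<open>B \<union> C\<close> with \<open>B \<in> I\<close>, \<open>C \<in> J\<close> form an ideal of strongly porous sets above \<open>I\<close>, so by
  maximality they all lie in \<open>I\<close>. Taking for \<open>J\<close> all subsets of one
  set turns this into a criterion for that set to belong to \<open>I\<close>.
\<close>

lemma SP_maximal_absorbs:
  assumes max: "SP_maximal I"
    and J: "J \<subseteq> Pow nonneg_reals" "{} \<in> J" "\<And>B C. B \<in> J \<Longrightarrow> C \<subseteq> B \<Longrightarrow> C \<in> J"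
      "\<And>B C. B \<in> J \<Longrightarrow> C \<in> J \<Longrightarrow> B \<union> C \<in> J"
    and sp: "\<And>B C. B \<in> I \<Longrightarrow> C \<in> J \<Longrightarrow> strongly_porous (B \<union> C)"
  shows "J \<subseteq> I"
proof -
  note I = SP_maximal_ideal[OF max]
  define L where "L = {B \<union> C |B C. B \<in> I \<and> C \<in> J}"
  have LI: "B \<union> C \<in> L" if "B \<in> I" "C \<in> J" for B C using that by (auto simp: L_def)
  have "I \<subseteq> L" using LI[OF _ J(2)] by auto
  have "L \<subseteq> SP" unfolding L_def SP_def using sp I(1) J(1) by blast
  have "ideal_on nonneg_reals L"
    unfolding ideal_on_def
  proof (intro conjI allI impI; (elim conjE)?)
    show "L \<subseteq> Pow nonneg_reals" using \<open>L \<subseteq> SP\<close> by (auto simp: SP_def)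
    show "L \<noteq> {}" using \<open>I \<subseteq> L\<close> I(2) by blast
    show "nonneg_reals \<notin> L"
      using \<open>L \<subseteq> SP\<close> not_strongly_porous_nonneg_reals by (auto simp: SP_def)
  next
    fix D E assume "D \<in> L" "E \<subseteq> D"
    then obtain B C where BC: "B \<in> I" "C \<in> J" "E \<subseteq> B \<union> C" by (auto simp: L_def)
    have "(E \<inter> B) \<union> (E \<inter> C) \<in> L" using BC(1,2) I(3) J(3) by (intro LI) auto
    moreover have "(E \<inter> B) \<union> (E \<inter> C) = E" using BC(3) by blast
    ultimately show "E \<in> L" by simp
  next
    fix D E assume "D \<in> L" "E \<in> L"
    then obtain B C B' C' where D: "D = B \<union> C" "B \<in> I" "C \<in> J" and E: "E = B' \<union> C'" "B' \<in> I" "C' \<in> J"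
      by (auto simp: L_def)
    have "(B \<union> B') \<union> (C \<union> C') \<in> L" using D E I(4) J(4) by (intro LI) auto
    then show "D \<union> E \<in> L" using D(1) E(1) by (simp add: Un_ac)
  qed
  with max \<open>I \<subseteq> L\<close> \<open>L \<subseteq> SP\<close> have "I = L" by (simp add: SP_maximal_def)
  then show ?thesis using LI[OF I(2)] by auto
qed

lemma SP_maximal_fattening:
  assumes max: "SP_maximal I" and A: "A \<in> I" and K: "K \<ge> 1" and c: "c > 0"
  shows "fattening K A \<union> {0} \<union> {c..} \<in> I"
proof -
  let ?F = "fattening K A \<union> {0} \<union> {c..}"
  have "Pow ?F \<subseteq> I"
  proof (rule SP_maximal_absorbs[OF max])
    show "Pow ?F \<subseteq> Pow nonneg_reals" using c by (auto simp: fattening_def)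
  next
    fix B C assume B: "B \<in> I" and C: "C \<in> Pow ?F"
    have "B \<union> A \<in> I" using SP_maximal_ideal(4)[OF max B A] .
    then have "strongly_porous (B \<union> A)"
      using max by (auto simp: SP_maximal_def SP_def)
    then have "strongly_porous (B \<union> ?F)" using K c by (rule strongly_porous_fattening)
    then show "strongly_porous (B \<union> C)" by (rule strongly_porous_subset) (use C in blast)
  qed auto
  then show ?thesis by blast
qed

lemma SP_maximal_eqI:
  assumes I1: "SP_maximal I1" and I2: "SP_maximal I2"
    and sp: "\<And>A B. A \<in> I1 \<Longrightarrow> B \<in> I2 \<Longrightarrow> strongly_porous (A \<union> B)"
  shows "I1 = I2"
proof -
  have sp': "strongly_porous (B \<union> A)" if "B \<in> I2" "A \<in> I1" for A B
    using sp[OF that(2,1)] by (simp add: Un_commute)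
  have "I2 \<subseteq> I1"
    by (rule SP_maximal_absorbs[OF I1 SP_maximal_ideal[OF I2] sp])
  moreover have "I1 \<subseteq> I2"
    by (rule SP_maximal_absorbs[OF I2 SP_maximal_ideal[OF I1] sp'])
  ultimately show ?thesis by blast
qed

theorem theorem3p13:
  fixes I1 I2 :: "real set set"
  assumes "SP_maximal I1"
    and "SP_maximal I2"
    and "I1 \<noteq> I2"
  shows "\<exists>A \<in> I1. nonneg_reals - A \<in> I2"
proof -
  obtain A B where AB: "A \<in> I1" "B \<in> I2" "\<not> strongly_porous (A \<union> B)"
    using SP_maximal_eqI assms by blast
  then obtain K \<delta> where K: "K > 1" and \<delta>: "\<delta> > 0"
    and dense: "\<And>x. 0 < x \<Longrightarrow> x < \<delta> \<Longrightarrow> {x<..<K * x} \<inter> (A \<union> B) \<noteq> {}"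
    unfolding strongly_porous_iff_gaps by blast
  let ?A = "fattening K A \<union> {0} \<union> {\<delta>..}" and ?B = "fattening K B \<union> {0} \<union> {\<delta>..}"
  have mem: "?A \<in> I1" "?B \<in> I2"
    using SP_maximal_fattening assms AB K \<delta> by simp_all
  have "x \<in> fattening K A \<or> x \<in> fattening K B" if x: "0 < x" "x < \<delta>" for x
  proof -
    obtain a where "a \<in> {x<..<K * x} \<inter> (A \<union> B)" using dense[OF x] by blast
    then have a: "a \<in> A \<union> B" "x < a" "a < K * x" by auto
    have "a \<le> K * a" using a(2) x(1) K by simp
    then have "x \<le> K * a" using a(2) by simp
    then show ?thesis using a x(1) by (auto simp: fattening_def)
  qed
  then have "x \<in> ?B" if "x \<in> nonneg_reals - ?A" for x
    using that by (metis DiffD1 DiffD2 UnCI atLeast_iff insertI1 less_eq_real_def linorder_not_le)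
  then have "nonneg_reals - ?A \<subseteq> ?B" by (rule subsetI)
  then have "nonneg_reals - ?A \<in> I2"
    by (rule SP_maximal_ideal(3)[OF assms(2) mem(2)])
  then show ?thesis using mem(1) by blast
qed

end
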